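(* Let $\beta=(\beta_x,\beta_y)\in(0,+\infty)^2$, $f\in\Gamma_0(\mathcal X)$ and $z=(x,y)\in\mathcal Z$. Then $$\mathcal G_\beta(z)\ \le\ \underline{\beta}\,\mathcal K(z),\qquad \underline\beta=\max\Big(\frac1{\beta_x},\frac1{2\beta_y}\Big).$$
   Context: $\mathcal X,\mathcal Y$ are finite-dimensional Euclidean spaces, $\mathcal Z=\mathcal X\times\mathcal Y$. $\Gamma_0(\mathcal X)$ is the set of proper, lower semicontinuous, convex functions $\mathcal X\to\mathbb R\cup\{+\infty\}$. $A:\mathcal X\to\mathcal Y$ is linear with adjoint $A^T$, and $b\in\mathcal Y$. For a set $\mathcal Q$, $\|\mathcal Q\|_0=\min\{\|q\|:q\in\mathcal Q\}$, with value $+\infty$ if $\mathcal Q=\emptyset$. The Karush-Kuhn-Tucker error is $\mathcal K(z)=\|\partial f(x)+A^Ty\|_0^2+\|Ax-b\|^2$. The self-centered smoothed duality gap is $$\mathcal G_\beta(z)=f(x)-f(p)+\langle A(x-p),y\rangle-\tfrac{\beta_x}{2}\|p-x\|^2+\tfrac1{2\beta_y}\|Ax-b\|^2,\qquad p=\mathrm{Prox}_{\beta_x^{-1}f}\big(x-\tfrac1{\beta_x}A^Ty\big),$$ where $\mathrm{Prox}_{sf}(x)=\arg\min_{x'}f(x')+\frac1{2s}\|x'-x\|^2$. The saddle point problem $\min_x\max_y f(x)+\langle Ax-b,y\rangle$ is assumed throughout to have a solution. *)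

theory Defs
  imports "HOL-Analysis.Analysis"
begin

definition proper_fun :: "('a \<Rightarrow> ereal) \<Rightarrow> bool" where
  "proper_fun f \<longleftrightarrow> (\<forall>x. f x \<noteq> -\<infinity>) \<and> (\<exists>x. f x \<noteq> \<infinity>)"

definition lower_semicontinuous :: "('a::topological_space \<Rightarrow> ereal) \<Rightarrow> bool" where
  "lower_semicontinuous f \<longleftrightarrow> (\<forall>x. f x \<le> Liminf (at x) f)"

(* The library predicate convex_on is for real-valued functions only.  In ereal, 0 * \<infinity> = 0,
   so the end points t = 0 and t = 1 impose no condition. *)
definition convex_fun :: "('a::real_vector \<Rightarrow> ereal) \<Rightarrow> bool" where
  "convex_fun f \<longleftrightarrow> (\<forall>x y. \<forall>t\<in>{0..1}.
     f ((1 - t) *\<^sub>R x + t *\<^sub>R y) \<le> ereal (1 - t) * f x + ereal t * f y)"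

definition Gamma0 :: "('a::euclidean_space \<Rightarrow> ereal) set" where
  "Gamma0 = {f. proper_fun f \<and> lower_semicontinuous f \<and> convex_fun f}"

definition subdifferential :: "('a::real_inner \<Rightarrow> ereal) \<Rightarrow> 'a \<Rightarrow> 'a set" where
  "subdifferential f x = {g. \<forall>u. f x + ereal (g \<bullet> (u - x)) \<le> f u}"

(* A minimum, not an infimum: meaningful for the closed sets to which it is applied. *)
definition min_norm :: "'a::real_normed_vector set \<Rightarrow> ereal" where
  "min_norm Q = (if Q = {} then \<infinity> else ereal (LEAST r. r \<in> norm ` Q))"

(* For s > 0 and f in Gamma0 the minimiser exists and is unique. *)
definition prox :: "real \<Rightarrow> ('a::real_normed_vector \<Rightarrow> ereal) \<Rightarrow> 'a \<Rightarrow> 'a" where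
  "prox s f x = arg_min_on (\<lambda>u. f u + ereal (1 / (2 * s) * (norm (u - x))\<^sup>2)) UNIV"

definition lagrangian ::
  "('a::euclidean_space \<Rightarrow> ereal) \<Rightarrow> ('a \<Rightarrow> 'b::euclidean_space) \<Rightarrow> 'b \<Rightarrow> 'a \<Rightarrow> 'b \<Rightarrow> ereal" where
  "lagrangian f A b x y = f x + ereal ((A x - b) \<bullet> y)"

definition saddle_point :: "('a \<Rightarrow> 'b \<Rightarrow> ereal) \<Rightarrow> 'a \<times> 'b \<Rightarrow> bool" where
  "saddle_point L = (\<lambda>(x, y). \<forall>x' y'. L x y' \<le> L x y \<and> L x y \<le> L x' y)"

definition KKT_error ::
  "('a::euclidean_space \<Rightarrow> ereal) \<Rightarrow> ('a \<Rightarrow> 'b::euclidean_space) \<Rightarrow> 'b \<Rightarrow> 'a \<times> 'b \<Rightarrow> ereal" where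
  "KKT_error f A b = (\<lambda>(x, y).
     (min_norm ((\<lambda>g. g + adjoint A y) ` subdifferential f x))\<^sup>2 + ereal ((norm (A x - b))\<^sup>2))"

(* Since f p < \<infinity> for p = prox ..., the difference f x - f p is never \<infinity> - \<infinity>;
   it is \<infinity> exactly when x lies outside the domain of f. *)
definition smoothed_gap ::
  "real \<times> real \<Rightarrow> ('a::euclidean_space \<Rightarrow> ereal) \<Rightarrow> ('a \<Rightarrow> 'b::euclidean_space) \<Rightarrow> 'b
     \<Rightarrow> 'a \<times> 'b \<Rightarrow> ereal" where
  "smoothed_gap = (\<lambda>(\<beta>x, \<beta>y) f A b (x, y).
     let p = prox (1 / \<beta>x) f (x - (1 / \<beta>x) *\<^sub>R adjoint A y) in
       f x - f p + ereal (A (x - p) \<bullet> y) - ereal (\<beta>x / 2 * (norm (p - x))\<^sup>2)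
         + ereal (1 / (2 * \<beta>y) * (norm (A x - b))\<^sup>2))"

end

theory Submission
  imports Defs
begin

text \<open>
  If \<open>\<partial>f(x)\<close> is empty, the right-hand side is infinite. Otherwise let \<open>q = g + A\<^sup>T y\<close> be the
  element of least norm in \<open>\<partial>f(x) + A\<^sup>T y\<close>. The subgradient inequality at \<open>p\<close> bounds the gap by
  \<open>\<langle>q, x - p\<rangle> - \<beta>\<^sub>x/2 \<parallel>x - p\<parallel>\<^sup>2 + \<parallel>Ax - b\<parallel>\<^sup>2/(2\<beta>\<^sub>y)\<close>, and Young's inequality bounds the first two
  terms by \<open>\<parallel>q\<parallel>\<^sup>2/(2\<beta>\<^sub>x)\<close>. The optimality of \<open>p\<close> plays no role: the estimate holds for every point.
\<close>

text \<open>With \<open>f x\<close> real, each \<open>u\<close> contributes a sublevel set of an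
  affine function of \<open>g\<close>, which is closed; the subdifferential is their
  intersection.\<close>

lemma closed_subdifferential:
  assumes "f x = ereal c"
  shows "closed (subdifferential f x)"
proof -
  have "closed {g. ereal (c + g \<bullet> (u - x)) \<le> f u}" for u
    by (intro closed_Collect_le continuous_on_ereal continuous_intros)
  moreover have "subdifferential f x = (\<Inter>u. {g. ereal (c + g \<bullet> (u - x)) \<le> f u})"
    using assms by (auto simp: subdifferential_def)
  ultimately show ?thesis by auto
qed

text \<open>The subgradient inequality at a point where \<open>f\<close> is finite bounds
  \<open>f x\<close> from above.\<close>

lemma proper_subdifferential_finite:
  assumes "proper_fun f" "g \<in> subdifferential f x"
  obtains c where "f x = ereal c"
proof -
  obtain u where "f u \<noteq> \<infinity>" using assms(1) by (auto simp: proper_fun_def)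
  moreover have "f x + ereal (g \<bullet> (u - x)) \<le> f u"
    using assms(2) by (simp add: subdifferential_def)
  ultimately have "f x \<noteq> \<infinity>" by auto
  moreover have "f x \<noteq> -\<infinity>" using assms(1) by (simp add: proper_fun_def)
  ultimately show thesis using that by (cases "f x") auto
qed

text \<open>A nonempty closed set in finite dimension has a point nearest to 0, so the
  \<open>LEAST\<close> in \<open>min_norm\<close> is a genuine minimum.\<close>

lemma min_norm_attained:
  fixes Q :: "'a::euclidean_space set"
  assumes "closed Q" "Q \<noteq> {}"
  obtains q where "q \<in> Q" "min_norm Q = ereal (norm q)"
proof -
  obtain q where q: "q \<in> Q" "\<And>r. r \<in> Q \<Longrightarrow> dist 0 q \<le> dist 0 r"
    using distance_attains_inf[OF assms, where a = 0] by metis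
  have "(LEAST r. r \<in> norm ` Q) = norm q"
    using q by (intro Least_equality) (auto simp: dist_norm)
  then have "min_norm Q = ereal (norm q)"
    using assms(2) by (simp add: min_norm_def)
  with q(1) show thesis by (rule that)
qed

lemma inner_le_Young:
  fixes q d :: "'a::real_inner"
  assumes "\<beta> > 0"
  shows "q \<bullet> d - \<beta> / 2 * (norm d)\<^sup>2 \<le> 1 / (2 * \<beta>) * (norm q)\<^sup>2"
proof -
  have "0 \<le> (norm (q - \<beta> *\<^sub>R d))\<^sup>2" by simp
  also have "\<dots> = (norm q)\<^sup>2 - 2 * \<beta> * (q \<bullet> d) + \<beta>\<^sup>2 * (norm d)\<^sup>2"
    unfolding power2_norm_eq_inner
    by (simp add: inner_diff_left inner_diff_right inner_commute power2_eq_square)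
  finally show ?thesis using assms by (simp add: field_simps power2_eq_square)
qed

lemma gap_le_subgradient:
  fixes A :: "'a::euclidean_space \<Rightarrow> 'b::euclidean_space"
  assumes "linear A" "\<beta>x > 0" "proper_fun f" "g \<in> subdifferential f x"
  shows "f x - f p + ereal (A (x - p) \<bullet> y) - ereal (\<beta>x / 2 * (norm (p - x))\<^sup>2)
    \<le> ereal (1 / (2 * \<beta>x) * (norm (g + adjoint A y))\<^sup>2)"
proof -
  obtain c where c: "f x = ereal c"
    using proper_subdifferential_finite[OF assms(3,4)] .
  have sub: "f x + ereal (g \<bullet> (p - x)) \<le> f p"
    using assms(4) by (simp add: subdifferential_def)
  show ?thesis
  proof (cases "f p")
    case (real d)
    \<comment> \<open>Passing to the adjoint lets this term merge with the one from \<open>g\<close>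
      into a single inner product with \<open>x - p\<close>.\<close>
    have "A (x - p) \<bullet> y = adjoint A y \<bullet> (x - p)"
      using adjoint_works[OF assms(1), of "x - p" y] by (simp add: inner_commute)
    moreover have "c - d \<le> g \<bullet> (x - p)"
      using sub c real by (simp add: inner_diff_right)
    ultimately show ?thesis
      using inner_le_Young[OF assms(2), of "g + adjoint A y" "x - p"] c real
      by (simp add: inner_add_left norm_minus_commute)
  next
    \<comment> \<open>Since \<open>f x\<close> is real, the left side is \<open>-\<infinity>\<close>
      here.\<close>
    case PInf
    then show ?thesis using c by simp
  next
    case MInf
    then show ?thesis using assms(3) by (simp add: proper_fun_def)
  qed
qed

theorem theorem5:
  fixes f :: "'a::euclidean_space \<Rightarrow> ereal"
    and A :: "'a \<Rightarrow> 'b::euclidean_space"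
    and b :: 'b
    and \<beta>x \<beta>y :: real
    and z :: "'a \<times> 'b"
  assumes "linear A"
    and "f \<in> Gamma0"
    and "\<exists>z'. saddle_point (lagrangian f A b) z'"
    and "\<beta>x > 0"
    and "\<beta>y > 0"
  shows "smoothed_gap (\<beta>x, \<beta>y) f A b z
           \<le> ereal (max (1 / \<beta>x) (1 / (2 * \<beta>y))) * KKT_error f A b z"
proof -
  obtain x y where z: "z = (x, y)" by (cases z)
  define M where "M = max (1 / \<beta>x) (1 / (2 * \<beta>y))"
  define Q where "Q = (\<lambda>g. g + adjoint A y) ` subdifferential f x"
  define p where "p = prox (1 / \<beta>x) f (x - (1 / \<beta>x) *\<^sub>R adjoint A y)"
  have M: "M > 0" "1 / (2 * \<beta>x) \<le> M" "1 / (2 * \<beta>y) \<le> M"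
    using assms(4,5) by (auto simp: M_def less_max_iff_disj le_max_iff_disj field_simps)
  have proper: "proper_fun f" using assms(2) by (simp add: Gamma0_def)
  have "smoothed_gap (\<beta>x, \<beta>y) f A b z \<le> ereal M * KKT_error f A b z"
  proof (cases "Q = {}")
    case True
    then have "KKT_error f A b z = \<infinity>"
      by (simp add: z KKT_error_def min_norm_def Q_def power2_eq_square)
    \<comment> \<open>Positivity of \<open>M\<close> matters: in \<open>ereal\<close> the product of
      0 and \<open>\<infinity>\<close> is 0.\<close>
    then show ?thesis using M(1) by simp
  next
    case False
    then obtain c where "f x = ereal c"
      using proper_subdifferential_finite[OF proper] by (metis Q_def equals0I image_empty)
    \<comment> \<open>\<open>Q\<close> is a translate of the subdifferential by
      \<open>adjoint A y\<close>.\<close>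
    then have "closed Q"
      using closed_translation[OF closed_subdifferential, of f x c "adjoint A y"]
      by (simp add: Q_def add.commute)
    then obtain q where q: "q \<in> Q" "min_norm Q = ereal (norm q)"
      using False by (rule min_norm_attained)
    then obtain g where g: "g \<in> subdifferential f x" "q = g + adjoint A y"
      by (auto simp: Q_def)
    have "smoothed_gap (\<beta>x, \<beta>y) f A b z
        \<le> ereal (1 / (2 * \<beta>x) * (norm q)\<^sup>2) + ereal (1 / (2 * \<beta>y) * (norm (A x - b))\<^sup>2)"
      unfolding z smoothed_gap_def prod.case Let_def p_def[symmetric] g(2)
      by (intro add_right_mono gap_le_subgradient[OF assms(1,4) proper g(1)])
    \<comment> \<open>Both coefficients are raised to \<open>M\<close>; the first, from Young, is
      only half of \<open>1 / \<beta>x\<close>.\<close>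
    also have "\<dots> \<le> ereal (M * (norm q)\<^sup>2 + M * (norm (A x - b))\<^sup>2)"
      unfolding plus_ereal.simps ereal_less_eq by (intro add_mono mult_right_mono M) auto
    also have "\<dots> = ereal M * KKT_error f A b z"
      using q(2) by (simp add: z KKT_error_def Q_def[symmetric] distrib_left)
    finally show ?thesis .
  qed
  then show ?thesis by (simp add: M_def)
qed

end
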